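(* Let $(X,\|\cdot\|,\Omega)$ be a semi-dispersing Minkowski billiard. Then for any point $p\in\overline{\Omega}$ and any $\varepsilon>0$ there exists a neighborhood $U$ of $p$ such that any billiard trajectory entirely contained in $U$ has length at most $\varepsilon$.
   Context: "Smooth" means $C^1$ throughout. Minkowski norm. A Minkowski space is a finite-dimensional real vector space $X$ with a Minkowski norm, i.e. a continuous function $\|\cdot\|\colon X\to\mathbb{R}$ such that: (i) $\|x\|>0$ for all $x\ne 0$; (ii) $\|tx\|=t\|x\|$ for all $x\in X$, $t\ge 0$; (iii) $\|x+y\|\le\|x\|+\|y\|$; (iv) strict convexity: the unit sphere $\{x:\|x\|=1\}$ contains no (nondegenerate) line segment; (v) $\|\cdot\|$ is $C^1$ on $X\setminus\{0\}$. The norm is not assumed symmetric: in general $\|x\|\ne\|-x\|$. Minkowski billiard. It is given by a Minkowski space $(X,\|\cdot\|)$ and a domain $\Omega\subset X$ (the billiard table), with closure $\overline{\Omega}$ and boundary $\partial\Omega$. A point $p\in\partial\Omega$ is smooth if in a neighborhood of $p$ the set $\partial\Omega$ is a smooth ($C^1$) hypersurface. Trajectory. A billiard trajectory is a continuous curve $\gamma\colon I\to\overline{\Omega}$, with $I\subset\mathbb{R}$ an interval, such that for every interior point $t\in I$ there is $\delta>0$ such that for all $t_1\in(t-\delta,t)$ and $t_2\in(t,t+\delta)$ at least one of the following holds: (1) $\gamma|_{[t_1,t_2]}$ parametrizes a segment of an affine line in $X$ with unit speed ($\|\dot\gamma\|=1$); (2) $p=\gamma(t)$ is a smooth point of $\partial\Omega$,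 the restrictions $\gamma|_{[t_1,t]}$ and $\gamma|_{[t,t_2]}$ are unit-speed parametrizations of the segments $[q_1,p]$ and $[p,q_2]$, where $q_1=\gamma(t_1)$, $q_2=\gamma(t_2)$, and $p$ is a critical point of the function $x\mapsto\|x-q_1\|+\|q_2-x\|$, $x\in\partial\Omega$. No condition is imposed at endpoints of $I$. The length of $\gamma$ is the length of the interval $I$. Semi-dispersing. The billiard is semi-dispersing if $\Omega=X\setminus\bigcup_{i=1}^m W_i$, where $W_1,\dots,W_m\subset X$ (the walls) are closed convex sets with nonempty interiors and smooth boundaries. *)

theory Defs
  imports "HOL-Analysis.Analysis"
begin

definition C1_on :: "('a::euclidean_space \<Rightarrow> real) \<Rightarrow> 'a set \<Rightarrow> bool" where
  "C1_on f S \<longleftrightarrow>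
     (\<exists>f' :: 'a \<Rightarrow> ('a \<Rightarrow>\<^sub>L real).
        (\<forall>x\<in>S. (f has_derivative blinfun_apply (f' x)) (at x)) \<and> continuous_on S f')"

text \<open>
  A Minkowski norm is a function of its own, not the class operation \<open>norm\<close>: the
  Euclidean structure of the type only serves to provide the topology of a
  finite-dimensional real vector space. The norm need not be symmetric.
\<close>

definition minkowski_norm :: "('a::euclidean_space \<Rightarrow> real) \<Rightarrow> bool" where
  "minkowski_norm N \<longleftrightarrow>
     continuous_on UNIV N \<and>
     (\<forall>x. x \<noteq> 0 \<longrightarrow> N x > 0) \<and>
     (\<forall>t x. t \<ge> 0 \<longrightarrow> N (t *\<^sub>R x) = t * N x) \<and>
     (\<forall>x y. N (x + y) \<le> N x + N y) \<and>
     (\<nexists>a b. a \<noteq> b \<and> closed_segment a b \<subseteq> {x. N x = 1}) \<and>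
     C1_on N (- {0})"

text \<open>
  Near \<open>p\<close> the set \<open>M\<close> is a \<open>C\<^sup>1\<close> hypersurface: a level set of a \<open>C\<^sup>1\<close> function
  without critical points.
\<close>

definition smooth_hypersurface_near :: "'a::euclidean_space set \<Rightarrow> 'a \<Rightarrow> bool" where
  "smooth_hypersurface_near M p \<longleftrightarrow>
     (\<exists>U g. open U \<and> p \<in> U \<and> C1_on g U \<and>
            (\<forall>x\<in>U. \<not> (g has_derivative (\<lambda>_. 0)) (at x)) \<and>
            M \<inter> U = {x\<in>U. g x = 0})"

definition smooth_point :: "'a::euclidean_space set \<Rightarrow> 'a \<Rightarrow> bool" where
  "smooth_point \<Omega> p \<longleftrightarrow> p \<in> frontier \<Omega> \<and> smooth_hypersurface_near (frontier \<Omega>) p"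

text \<open>
  The curves need only be differentiable at the base point; on a \<open>C\<^sup>1\<close>
  hypersurface this yields the same tangent space as \<open>C\<^sup>1\<close> curves do.
\<close>

definition tangent_vectors :: "'a::euclidean_space set \<Rightarrow> 'a \<Rightarrow> 'a set" where
  "tangent_vectors M p =
     {v. \<exists>c :: real \<Rightarrow> 'a. c 0 = p \<and> (\<forall>\<^sub>F s in at 0. c s \<in> M) \<and>
                          (c has_vector_derivative v) (at 0)}"

definition critical_point_on :: "('a::euclidean_space \<Rightarrow> real) \<Rightarrow> 'a set \<Rightarrow> 'a \<Rightarrow> bool" where
  "critical_point_on f M p \<longleftrightarrow>
     p \<in> M \<and>
     (\<exists>f'. (f has_derivative f') (at p) \<and> (\<forall>v\<in>tangent_vectors M p. f' v = 0))"

definition minkowski_billiard :: "('a::euclidean_space \<Rightarrow> real) \<Rightarrow> 'a set \<Rightarrow> bool" where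
  "minkowski_billiard N \<Omega> \<longleftrightarrow>
     minkowski_norm N \<and> open \<Omega> \<and> connected \<Omega> \<and> \<Omega> \<noteq> {}"

definition unit_speed_segment ::
  "('a::euclidean_space \<Rightarrow> real) \<Rightarrow> (real \<Rightarrow> 'a) \<Rightarrow> real \<Rightarrow> real \<Rightarrow> bool" where
  "unit_speed_segment N \<gamma> a b \<longleftrightarrow>
     (\<exists>v. N v = 1 \<and> (\<forall>s\<in>{a..b}. \<gamma> s = \<gamma> a + (s - a) *\<^sub>R v))"

text \<open>
  Only the values of \<open>\<gamma>\<close> on the interval \<open>I\<close> matter. The interval may be unbounded
  and may contain its endpoints or not.
\<close>

definition billiard_trajectory ::
  "('a::euclidean_space \<Rightarrow> real) \<Rightarrow> 'a set \<Rightarrow> real set \<Rightarrow> (real \<Rightarrow> 'a) \<Rightarrow> bool" where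
  "billiard_trajectory N \<Omega> I \<gamma> \<longleftrightarrow>
     is_interval I \<and> continuous_on I \<gamma> \<and> \<gamma> ` I \<subseteq> closure \<Omega> \<and>
     (\<forall>t\<in>interior I. \<exists>\<delta>>0. {t - \<delta><..<t + \<delta>} \<subseteq> I \<and>
        (\<forall>t1\<in>{t - \<delta><..<t}. \<forall>t2\<in>{t<..<t + \<delta>}.
           unit_speed_segment N \<gamma> t1 t2 \<or>
           smooth_point \<Omega> (\<gamma> t) \<and>
           unit_speed_segment N \<gamma> t1 t \<and> unit_speed_segment N \<gamma> t t2 \<and>
           critical_point_on (\<lambda>x. N (x - \<gamma> t1) + N (\<gamma> t2 - x)) (frontier \<Omega>) (\<gamma> t)))"

definition semi_dispersing :: "'a::euclidean_space set \<Rightarrow> bool" where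
  "semi_dispersing \<Omega> \<longleftrightarrow>
     (\<exists>(m::nat) (W :: nat \<Rightarrow> 'a set).
        (\<forall>i\<in>{1..m}. closed (W i) \<and> convex (W i) \<and> interior (W i) \<noteq> {} \<and>
           (\<forall>p\<in>frontier (W i). smooth_hypersurface_near (frontier (W i)) p)) \<and>
        \<Omega> = UNIV - (\<Union>i\<in>{1..m}. W i))"

end

theory Submission imports Defs begin

text \<open>
  Call the differential \<open>\<xi>(v) = dN(v)\<close> of the norm at a unit velocity \<open>v\<close> the momentum. The proof
  follows the quantity \<open>f(t) = \<xi>(v(t)) (\<gamma>(t) - p)\<close> along a trajectory that stays so close to \<open>p\<close>
  that it only meets walls containing \<open>p\<close>.

  Between collisions \<open>\<xi>\<close> is constant and \<open>f\<close> has slope \<open>\<xi>(v) v = N v = 1\<close>. At a collision point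
  \<open>x\<close> of a wall \<open>W\<close> with outer normal \<open>n\<close>, criticality says that the jump of the momentum vanishes
  on the tangent hyperplane, so that it equals \<open>c n\<close> for a scalar \<open>c\<close>. Convexity of the norm
  (\<open>\<xi>(v) w \<le> N w\<close>) together with the fact that the trajectory arrives from outside the wall and
  leaves to the outside forces \<open>c \<ge> 0\<close>; strict convexity settles the grazing case. Since
  \<open>p \<in> W\<close>, one has \<open>n \<bullet> (x - p) \<ge> 0\<close>, and \<open>f\<close> does not decrease. Hence \<open>f(b) - f(a) \<ge> b - a\<close>. But
  \<open>- N (p - \<gamma>(t)) \<le> f(t) \<le> N (\<gamma>(t) - p)\<close>, so on the neighborhood where both norms are below
  \<open>\<epsilon> / 2\<close> no trajectory lasts longer than \<open>\<epsilon>\<close>.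

  The geometric input is \<open>collision_momentum_jump\<close>. Its delicate point is that criticality
  refers to tangent vectors of the boundary of the table, whereas the sign argument needs the
  tangent hyperplane of a single wall. That the two agree rests on
  \<open>tangent_vectors_eq_hyperplane\<close>: the tangent space of a regular \<open>C\<^sup>1\<close> level set is a full
  hyperplane, hence it equals every hyperplane that contains it. The growth of \<open>f\<close> is a local statement at
  every time, made global in \<open>paired_momentum_growth\<close> by a compactness argument.
\<close>

section \<open>Tangent hyperplanes of level sets and of smooth walls\<close>

text \<open>
  Every kernel vector is the velocity of a curve in the level set. For small \<open>s\<close> the point
  \<open>p + s w\<close> is corrected by a multiple of a vector \<open>n\<close> with \<open>g' n = 1\<close> so that it lies on the level
  set: since \<open>g (p + s w + \<tau> n) = \<tau> + o(\<bar>s\<bar> + \<bar>\<tau>\<bar>)\<close>, the intermediate value theorem provides a root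
  \<open>\<tau>\<close> with \<open>\<bar>\<tau>\<bar> \<le> e \<bar>s\<bar>\<close> for any prescribed \<open>e > 0\<close>. It replaces the implicit function theorem
  because \<open>g\<close> is only differentiable at the point \<open>p\<close> itself.
\<close>

lemma kernel_subset_tangent_vectors:
  fixes g :: "'a::euclidean_space \<Rightarrow> real"
  assumes U: "open U" "p \<in> U" and cont: "continuous_on U g"
    and der: "(g has_derivative g') (at p)" and nz: "g' \<noteq> (\<lambda>_. 0)"
    and M: "M \<inter> U = {x\<in>U. g x = 0}" and pM: "p \<in> M" and w: "g' w = 0"
  shows "w \<in> tangent_vectors M p"
proof -
  interpret g': bounded_linear g' using der by (rule has_derivative_bounded_linear)
  obtain n0 where "g' n0 \<noteq> 0" using nz by auto
  then have "g' ((1 / g' n0) *\<^sub>R n0) = 1" by (simp add: g'.scaleR)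
  then obtain n where n: "g' n = 1" by blast
  have gp: "g p = 0" using M pM U by blast
  obtain r where r: "r > 0" "ball p r \<subseteq> U" using U open_contains_ball by blast
  define y where "y s \<tau> = p + s *\<^sub>R w + \<tau> *\<^sub>R n" for s \<tau> :: real
  define R where "R s = {\<tau>. y s \<tau> \<in> U \<and> g (y s \<tau>) = 0}" for s
  define L where "L = norm w + norm n + 1"
  have L: "L > 0" unfolding L_def by (simp add: add_nonneg_pos)
  have root: "\<exists>\<delta>>0. \<forall>s. \<bar>s\<bar> < \<delta> \<longrightarrow> (\<exists>\<tau>\<in>R s. \<bar>\<tau>\<bar> \<le> e * \<bar>s\<bar>)"
    if e: "0 < e" "e \<le> 1" for e
  proof -
    have "e / (2 * L) > 0" using e L by simp
    then obtain d where d: "d > 0"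
      and dd: "\<And>z. norm (z - p) < d \<Longrightarrow> norm (g z - g p - g' (z - p)) \<le> e / (2 * L) * norm (z - p)"
      using der unfolding has_derivative_at_alt by blast
    define \<delta> where "\<delta> = min d r / L"
    have "\<delta> > 0" using d r L by (simp add: \<delta>_def)
    moreover have "\<exists>\<tau>\<in>R s. \<bar>\<tau>\<bar> \<le> e * \<bar>s\<bar>" if s: "\<bar>s\<bar> < \<delta>" for s
    proof -
      have ny: "norm (y s \<tau> - p) \<le> \<bar>s\<bar> * L" if "\<bar>\<tau>\<bar> \<le> e * \<bar>s\<bar>" for \<tau>
      proof -
        have t: "\<bar>\<tau>\<bar> \<le> \<bar>s\<bar>" using that e mult_right_mono[of e 1 "\<bar>s\<bar>"] by simp
        have "norm (y s \<tau> - p) \<le> \<bar>s\<bar> * norm w + \<bar>\<tau>\<bar> * norm n"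
          unfolding y_def using norm_triangle_ineq[of "s *\<^sub>R w" "\<tau> *\<^sub>R n"] by (simp add: algebra_simps)
        also have "\<dots> \<le> \<bar>s\<bar> * norm w + \<bar>s\<bar> * norm n" using t by (simp add: mult_right_mono)
        also have "\<dots> \<le> \<bar>s\<bar> * L" by (simp add: L_def algebra_simps)
        finally show ?thesis .
      qed
      have sL: "\<bar>s\<bar> * L < min d r" using s L by (simp add: \<delta>_def pos_less_divide_eq)
      have near: "norm (y s \<tau> - p) < d" "y s \<tau> \<in> U" if "\<bar>\<tau>\<bar> \<le> e * \<bar>s\<bar>" for \<tau>
      proof -
        have "norm (y s \<tau> - p) < d \<and> norm (y s \<tau> - p) < r" using ny[OF that] sL by linarith
        then show "norm (y s \<tau> - p) < d" "y s \<tau> \<in> U"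
          using r by (auto simp: dist_norm norm_minus_commute)
      qed
      have g'y: "g' (y s \<tau> - p) = \<tau>" for \<tau>
        by (simp add: y_def g'.add g'.scaleR w n)
      have err: "\<bar>g (y s \<tau>) - \<tau>\<bar> \<le> e * \<bar>s\<bar> / 2" if t: "\<bar>\<tau>\<bar> \<le> e * \<bar>s\<bar>" for \<tau>
      proof -
        have "\<bar>g (y s \<tau>) - \<tau>\<bar> \<le> e / (2 * L) * norm (y s \<tau> - p)"
          using dd[OF near(1)[OF t]] by (simp add: gp g'y)
        also have "\<dots> \<le> e / (2 * L) * (\<bar>s\<bar> * L)"
          using ny[OF t] e L by (intro mult_left_mono) auto
        also have "\<dots> = e * \<bar>s\<bar> / 2" using L by (simp add: field_simps)
        finally show ?thesis .
      qed
      have b: "0 \<le> e * \<bar>s\<bar>" using e by simp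
      have "continuous_on {- (e * \<bar>s\<bar>)..e * \<bar>s\<bar>} (\<lambda>\<tau>. g (y s \<tau>))"
      proof (rule continuous_on_compose2[OF cont])
        show "continuous_on {- (e * \<bar>s\<bar>)..e * \<bar>s\<bar>} (y s)"
          unfolding y_def by (intro continuous_intros)
        show "y s ` {- (e * \<bar>s\<bar>)..e * \<bar>s\<bar>} \<subseteq> U" using near(2) by (auto simp: abs_le_iff)
      qed
      moreover have "g (y s (- (e * \<bar>s\<bar>))) \<le> 0" "0 \<le> g (y s (e * \<bar>s\<bar>))"
        using err[of "- (e * \<bar>s\<bar>)"] err[of "e * \<bar>s\<bar>"] b
        unfolding abs_le_iff by linarith+
      ultimately obtain \<tau> where "- (e * \<bar>s\<bar>) \<le> \<tau>" "\<tau> \<le> e * \<bar>s\<bar>" "g (y s \<tau>) = 0"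
        using IVT'[of "\<lambda>\<tau>. g (y s \<tau>)" "- (e * \<bar>s\<bar>)" 0 "e * \<bar>s\<bar>"] b by auto
      then show ?thesis using near(2)[of \<tau>] unfolding R_def by (auto simp: abs_le_iff)
    qed
    ultimately show ?thesis by blast
  qed
  \<comment> \<open>The roots found above depend on \<open>e\<close>. A root of nearly minimal size, with slack \<open>s\<^sup>2\<close> because
    the minimum need not be attained, works for all \<open>e\<close> at once.\<close>
  define T where "T s = (if s = 0 then 0 else SOME \<tau>. \<tau> \<in> R s \<and> (\<forall>\<tau>'\<in>R s. \<bar>\<tau>\<bar> \<le> \<bar>\<tau>'\<bar> + s\<^sup>2))" for s
  have T: "T s \<in> R s \<and> (\<forall>\<tau>'\<in>R s. \<bar>T s\<bar> \<le> \<bar>\<tau>'\<bar> + s\<^sup>2)" if ne: "R s \<noteq> {}" and s: "s \<noteq> 0" for s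
  proof -
    have bdd: "bdd_below (abs ` R s)" by (rule bdd_belowI[of _ 0]) auto
    have "Inf (abs ` R s) < Inf (abs ` R s) + s\<^sup>2" using s by simp
    with ne obtain \<tau> where \<tau>: "\<tau> \<in> R s" "\<bar>\<tau>\<bar> < Inf (abs ` R s) + s\<^sup>2"
      using cInf_lessD[of "abs ` R s"] by blast
    have "\<bar>\<tau>\<bar> \<le> \<bar>\<tau>'\<bar> + s\<^sup>2" if "\<tau>' \<in> R s" for \<tau>'
      using \<tau>(2) cInf_lower[OF imageI[OF that, of abs] bdd] by linarith
    with \<tau>(1) have "\<exists>\<tau>. \<tau> \<in> R s \<and> (\<forall>\<tau>'\<in>R s. \<bar>\<tau>\<bar> \<le> \<bar>\<tau>'\<bar> + s\<^sup>2)" by blast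
    from someI_ex[OF this] show ?thesis using s by (simp add: T_def)
  qed
  have T_small: "\<exists>\<delta>>0. \<forall>s. \<bar>s\<bar> < \<delta> \<longrightarrow> \<bar>T s\<bar> \<le> e * \<bar>s\<bar>" if e: "e > 0" for e
  proof -
    define e' where "e' = min 1 (e / 2)"
    have e': "0 < e'" "e' \<le> 1" "e' \<le> e / 2" using e by (auto simp: e'_def)
    obtain \<delta> where \<delta>: "\<delta> > 0" "\<And>s. \<bar>s\<bar> < \<delta> \<Longrightarrow> \<exists>\<tau>\<in>R s. \<bar>\<tau>\<bar> \<le> e' * \<bar>s\<bar>"
      using root[OF e'(1,2)] by blast
    have "\<bar>T s\<bar> \<le> e * \<bar>s\<bar>" if s: "\<bar>s\<bar> < min \<delta> (e / 2)" for s
    proof (cases "s = 0")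
      case False
      obtain \<tau> where \<tau>: "\<tau> \<in> R s" "\<bar>\<tau>\<bar> \<le> e' * \<bar>s\<bar>" using \<delta>(2)[of s] s by auto
      have "\<bar>T s\<bar> \<le> \<bar>\<tau>\<bar> + s\<^sup>2" using T[of s] \<tau>(1) False by blast
      also have "s\<^sup>2 = \<bar>s\<bar> * \<bar>s\<bar>" by (simp add: power2_eq_square)
      also have "\<bar>s\<bar> * \<bar>s\<bar> \<le> e / 2 * \<bar>s\<bar>" using s by (intro mult_right_mono) auto
      also have "\<bar>\<tau>\<bar> \<le> e / 2 * \<bar>s\<bar>" using \<tau>(2) mult_right_mono[OF e'(3), of "\<bar>s\<bar>"] by simp
      finally show ?thesis by simp
    qed (simp add: T_def)
    then show ?thesis using \<delta>(1) e by (intro exI[of _ "min \<delta> (e / 2)"]) auto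
  qed
  have "(T has_derivative (\<lambda>_. 0)) (at 0)"
    unfolding has_derivative_at_alt using T_small by (auto simp: T_def)
  then have "((\<lambda>s. y s (T s)) has_derivative (\<lambda>s. s *\<^sub>R w)) (at 0)"
    unfolding y_def by (auto intro!: derivative_eq_intros)
  then have vd: "((\<lambda>s. y s (T s)) has_vector_derivative w) (at 0)"
    by (simp add: has_vector_derivative_def)
  have ev: "\<forall>\<^sub>F s in at 0. y s (T s) \<in> M"
  proof -
    obtain \<delta> where \<delta>: "\<delta> > 0" "\<And>s. \<bar>s\<bar> < \<delta> \<Longrightarrow> \<exists>\<tau>\<in>R s. \<bar>\<tau>\<bar> \<le> 1 * \<bar>s\<bar>"
      using root[of 1] by auto
    have "y s (T s) \<in> M" if "s \<noteq> 0" "\<bar>s\<bar> < \<delta>" for s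
    proof -
      have "T s \<in> R s" using T[of s] \<delta>(2)[of s] that by blast
      then show ?thesis using M unfolding R_def by blast
    qed
    then show ?thesis unfolding eventually_at using \<delta>(1) by (auto simp: dist_norm)
  qed
  have y0: "y 0 (T 0) = p" by (simp add: y_def T_def)
  show ?thesis unfolding tangent_vectors_def
    by (intro CollectI exI[of _ "\<lambda>s. y s (T s)"] conjI y0 ev vd)
qed

text \<open>
  The tangent space contains the kernel of \<open>g'\<close>, which has codimension one, and lies in the
  given hyperplane; so all three coincide.
\<close>

lemma tangent_vectors_eq_hyperplane:
  assumes M: "smooth_hypersurface_near M x" "x \<in> M" and n: "n \<noteq> 0"
    and orth: "\<And>v. v \<in> tangent_vectors M x \<Longrightarrow> n \<bullet> v = 0"
  shows "tangent_vectors M x = {v. n \<bullet> v = 0}"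
proof -
  obtain U g where U: "open U" "x \<in> U" and C1: "C1_on g U"
    and nz: "\<And>z. z \<in> U \<Longrightarrow> \<not> (g has_derivative (\<lambda>_. 0)) (at z)" and MU: "M \<inter> U = {z\<in>U. g z = 0}"
    using M(1) unfolding smooth_hypersurface_near_def by blast
  obtain g' where g': "\<And>z. z \<in> U \<Longrightarrow> (g has_derivative blinfun_apply (g' z)) (at z)"
    using C1 unfolding C1_on_def by blast
  have cont: "continuous_on U g"
    using g' by (auto intro!: continuous_at_imp_continuous_on has_derivative_continuous)
  have nz': "blinfun_apply (g' x) \<noteq> (\<lambda>_. 0)" using nz[OF U(2)] g'[OF U(2)] by metis
  have ker: "v \<in> tangent_vectors M x" if "blinfun_apply (g' x) v = 0" for v
    using kernel_subset_tangent_vectors[OF U cont g'[OF U(2)] nz' MU M(2) that] .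
  obtain e where e: "blinfun_apply (g' x) e \<noteq> 0" using nz' by auto
  have rep: "n \<bullet> v = (blinfun_apply (g' x) v / blinfun_apply (g' x) e) * (n \<bullet> e)" for v
  proof -
    have "blinfun_apply (g' x) (v - (blinfun_apply (g' x) v / blinfun_apply (g' x) e) *\<^sub>R e) = 0"
      using e by (simp add: blinfun.diff_right blinfun.scaleR_right)
    from orth[OF ker[OF this]] show ?thesis by (simp add: inner_diff_right)
  qed
  have "n \<bullet> e \<noteq> 0" using rep[of n] n by auto
  then have "v \<in> tangent_vectors M x" if "n \<bullet> v = 0" for v
    using rep[of v] that e ker by auto
  then show ?thesis using orth by blast
qed

lemma functional_vanishing_on_hyperplane:
  fixes n :: "'a::euclidean_space" and l :: "'a \<Rightarrow> real"
  assumes "linear l" "n \<noteq> 0" "\<And>v. n \<bullet> v = 0 \<Longrightarrow> l v = 0"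
  shows "\<exists>c. \<forall>v. l v = c * (n \<bullet> v)"
proof (intro exI allI)
  fix v
  have "n \<bullet> (v - ((n \<bullet> v) / (n \<bullet> n)) *\<^sub>R n) = 0" using assms(2) by (simp add: inner_diff_right)
  from assms(3)[OF this] have "l v = ((n \<bullet> v) / (n \<bullet> n)) * l n"
    using assms(1) by (simp add: linear_diff linear_scale)
  then show "l v = (l n / (n \<bullet> n)) * (n \<bullet> v)" by simp
qed

text \<open>
  Separating the interior of \<open>W\<close> from a ray starting at \<open>x\<close> gives a supporting normal at \<open>x\<close> that
  also controls the direction of the ray. The case \<open>w = 0\<close> is the supporting hyperplane theorem.
\<close>

lemma supporting_normal_avoiding_ray:
  fixes W :: "'a::euclidean_space set"
  assumes W: "closed W" "convex W" "interior W \<noteq> {}" and x: "x \<in> W"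
    and ray: "\<And>s. s \<ge> 0 \<Longrightarrow> x + s *\<^sub>R w \<notin> interior W"
  shows "\<exists>n. n \<noteq> 0 \<and> (\<forall>y\<in>W. n \<bullet> (y - x) \<le> 0) \<and> n \<bullet> w \<ge> 0"
proof -
  define T where "T = (\<lambda>s. x + s *\<^sub>R w) ` {0..}"
  have T: "T \<noteq> {}" "interior W \<inter> T = {}" using ray by (auto simp: T_def)
  have "T = (+) x ` ((\<lambda>s. s *\<^sub>R w) ` {0..})" by (auto simp: T_def image_image)
  then have "convex T"
    by (auto intro!: convex_translation convex_linear_image simp: linear_scaleR_left)
  with separating_hyperplane_sets[OF convex_interior[OF W(2)] this W(3) T]
  obtain n b where n: "n \<noteq> 0" and I: "\<And>y. y \<in> interior W \<Longrightarrow> n \<bullet> y \<le> b"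
    and Tb: "\<And>s. s \<ge> 0 \<Longrightarrow> b \<le> n \<bullet> (x + s *\<^sub>R w)"
    unfolding T_def by blast
  have "W = closure (interior W)" using W convex_closure_interior closure_closed by metis
  moreover have "closure (interior W) \<subseteq> {y. n \<bullet> y \<le> b}"
    by (rule closure_minimal) (use I in \<open>auto simp: closed_halfspace_le\<close>)
  ultimately have Wb: "\<And>y. y \<in> W \<Longrightarrow> n \<bullet> y \<le> b" by blast
  have "b = n \<bullet> x" using Wb[OF x] Tb[of 0] by simp
  then show ?thesis
    using n Wb Tb[of 1] by (intro exI[of _ n]) (auto simp: inner_diff_right inner_add_right)
qed

lemma supporting_normal_neg_on_interior:
  fixes n :: "'a::euclidean_space"
  assumes "n \<noteq> 0" "\<And>y. y \<in> W \<Longrightarrow> n \<bullet> (y - x) \<le> 0" "z \<in> interior W"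
  shows "n \<bullet> (z - x) < 0"
proof -
  obtain r where r: "r > 0" "cball z r \<subseteq> W" using assms(3) by (meson mem_interior_cball)
  have "z + (r / norm n) *\<^sub>R n \<in> W" using r by (intro subsetD[OF r(2)]) (simp add: dist_norm)
  from assms(2)[OF this] have "n \<bullet> (z - x) + (r / norm n) * (n \<bullet> n) \<le> 0"
    by (simp add: inner_diff_right inner_add_right)
  moreover have "(r / norm n) * (n \<bullet> n) > 0" using r assms(1) by simp
  ultimately show ?thesis by linarith
qed

text \<open>
  Here the smoothness of the wall enters: it makes the supporting normal unique. A direction
  with \<open>n \<bullet> w < 0\<close> that never enters the interior would yield a second supporting normal \<open>k\<close> with
  \<open>k \<bullet> w \<ge> 0\<close>, not a positive multiple of \<open>n\<close>. At a corner the conclusion fails.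
\<close>

lemma smooth_wall_tangent_halfspace:
  fixes W :: "'a::euclidean_space set"
  assumes W: "closed W" "convex W" "interior W \<noteq> {}" and x: "x \<in> frontier W"
    and sm: "smooth_hypersurface_near (frontier W) x"
  obtains n where "n \<noteq> 0" "\<And>y. y \<in> W \<Longrightarrow> n \<bullet> (y - x) \<le> 0"
    "\<And>w. n \<bullet> w < 0 \<Longrightarrow> \<exists>s>0. x + s *\<^sub>R w \<in> interior W"
proof -
  have xW: "x \<in> W" and xI: "x \<notin> interior W" using x W(1) by (auto simp: frontier_def)
  have tan: "tangent_vectors (frontier W) x = {v. n \<bullet> v = 0}"
    if n: "n \<noteq> 0" and sup: "\<And>y. y \<in> W \<Longrightarrow> n \<bullet> (y - x) \<le> 0" for n
  proof (rule tangent_vectors_eq_hyperplane[OF sm x n])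
    fix v assume "v \<in> tangent_vectors (frontier W) x"
    then obtain c where c: "c 0 = x" "\<forall>\<^sub>F s in at (0::real). c s \<in> frontier W"
      "(c has_vector_derivative v) (at 0)" unfolding tangent_vectors_def by blast
    have d: "((\<lambda>s. n \<bullet> (c s - x)) has_real_derivative n \<bullet> v) (at 0)"
      using c(3) unfolding has_vector_derivative_def has_field_derivative_def
      by (auto intro!: derivative_eq_intros simp: mult.commute)
    obtain d where "d > 0" "\<And>s. s \<noteq> 0 \<Longrightarrow> \<bar>s\<bar> < d \<Longrightarrow> c s \<in> frontier W"
      using c(2) unfolding eventually_at by (auto simp: dist_norm)
    moreover have "frontier W \<subseteq> W" using W(1) by (simp add: frontier_subset_closed)
    ultimately have "\<forall>s. \<bar>0 - s\<bar> < d \<longrightarrow> n \<bullet> (c s - x) \<le> n \<bullet> (c 0 - x)"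
      using sup c(1) by (metis (full_types) diff_0 abs_minus_cancel diff_self inner_zero_right subsetD order_refl)
    \<comment> \<open>A curve in the boundary of \<open>W\<close> does not cross the supporting hyperplane on both sides of time 0.\<close>
    with DERIV_local_max[OF d \<open>d > 0\<close>] show "n \<bullet> v = 0" by blast
  qed
  have ray0: "\<And>s. s \<ge> 0 \<Longrightarrow> x + s *\<^sub>R 0 \<notin> interior W" using xI by simp
  obtain n where n: "n \<noteq> 0" "\<And>y. y \<in> W \<Longrightarrow> n \<bullet> (y - x) \<le> 0"
    using supporting_normal_avoiding_ray[OF W xW ray0] by blast
  have "\<exists>s>0. x + s *\<^sub>R w \<in> interior W" if w: "n \<bullet> w < 0" for w
  proof (rule ccontr)
    assume no: "\<not> ?thesis"
    have ray: "x + s *\<^sub>R w \<notin> interior W" if "s \<ge> 0" for s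
      using no xI that by (cases "s = 0") auto
    obtain k where k: "k \<noteq> 0" "\<And>y. y \<in> W \<Longrightarrow> k \<bullet> (y - x) \<le> 0" "k \<bullet> w \<ge> 0"
      using supporting_normal_avoiding_ray[OF W xW ray] by blast
    have "k \<bullet> v = 0" if "n \<bullet> v = 0" for v
      using tan[OF n] tan[OF k(1,2)] that by blast
    from functional_vanishing_on_hyperplane[OF bounded_linear.linear[OF bounded_linear_inner_right] n(1) this]
    obtain c where c: "\<And>v. k \<bullet> v = c * (n \<bullet> v)" by blast
    obtain z where z: "z \<in> interior W" using W(3) by blast
    have "c * (n \<bullet> (z - x)) < 0" "n \<bullet> (z - x) < 0"
      using supporting_normal_neg_on_interior[OF k(1,2) z]
        supporting_normal_neg_on_interior[OF n z] c by auto
    then have "c > 0" by (simp add: mult_less_0_iff)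
    then show False using c[of w] k(3) w mult_pos_neg[of c "n \<bullet> w"] by linarith
  qed
  with n show ?thesis using that by blast
qed

lemma convex_interior_cone:
  fixes W :: "'a::euclidean_space set"
  assumes "convex W" "x \<in> W" "x + s0 *\<^sub>R w \<in> interior W" "s0 > 0"
  shows "\<exists>r>0. \<forall>s u. 0 < s \<and> s \<le> s0 \<and> norm (u - w) < r \<longrightarrow> x + s *\<^sub>R u \<in> interior W"
proof -
  obtain r where r: "r > 0" "ball (x + s0 *\<^sub>R w) r \<subseteq> interior W"
    using assms(3) open_interior open_contains_ball by blast
  have "x + s *\<^sub>R u \<in> interior W" if s: "0 < s" "s \<le> s0" and u: "norm (u - w) < r / s0" for s u
  proof -
    have "dist (x + s0 *\<^sub>R w) (x + s0 *\<^sub>R u) = s0 * norm (u - w)"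
      using assms(4) by (simp add: dist_norm flip: scaleR_diff_right) (simp add: norm_minus_commute)
    also have "\<dots> < r" using u assms(4) by (simp add: pos_less_divide_eq mult.commute)
    finally have "x + s0 *\<^sub>R u \<in> interior W" using r(2) by auto
    from mem_interior_closure_convex_shrink[OF assms(1) this, of x "s / s0"] assms(2) closure_subset s assms(4)
    have "x - (s / s0) *\<^sub>R (x - (x + s0 *\<^sub>R u)) \<in> interior W" by auto
    then show ?thesis using assms(4) by simp
  qed
  then show ?thesis using r(1) assms(4) by (intro exI[of _ "r / s0"]) auto
qed

text \<open>
  At a smooth boundary point of the table the tangent space of the table's boundary is that of
  any wall through the point, even if several walls meet there: a tangent curve whose velocity
  (or its negative) pointed strictly into the wall would enter the open cone of interior
  directions, and so leave the boundary of the table.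
\<close>

lemma tangent_vectors_frontier_table:
  fixes W \<Omega> :: "'a::euclidean_space set"
  assumes W: "convex W" "x \<in> W" and disj: "\<Omega> \<inter> W = {}"
    and sm: "smooth_point \<Omega> x" and n: "n \<noteq> 0"
    and cone: "\<And>w. n \<bullet> w < 0 \<Longrightarrow> \<exists>s>0. x + s *\<^sub>R w \<in> interior W"
  shows "tangent_vectors (frontier \<Omega>) x = {v. n \<bullet> v = 0}"
proof (rule tangent_vectors_eq_hyperplane)
  show "smooth_hypersurface_near (frontier \<Omega>) x" "x \<in> frontier \<Omega>" "n \<noteq> 0"
    using sm n by (auto simp: smooth_point_def)
  have "interior W \<inter> closure \<Omega> = {}"
    using disj interior_subset[of W] by (subst open_Int_closure_eq_empty) auto
  then have off: "frontier \<Omega> \<inter> interior W = {}" by (auto simp: frontier_def)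
  fix v assume "v \<in> tangent_vectors (frontier \<Omega>) x"
  then obtain c where c: "c 0 = x" "\<forall>\<^sub>F s in at (0::real). c s \<in> frontier \<Omega>"
    "(c has_vector_derivative v) (at 0)" unfolding tangent_vectors_def by blast
  have lim: "((\<lambda>s. (1 / s) *\<^sub>R (c s - x)) \<longlongrightarrow> v) (at 0)"
  proof -
    have "((\<lambda>s. (c s - c 0 - s *\<^sub>R v) /\<^sub>R \<bar>s\<bar>) \<longlongrightarrow> 0) (at 0)"
      using c(3) by (simp add: has_vector_derivative_def has_derivative_at_within)
    then have "((\<lambda>s. norm ((c s - c 0 - s *\<^sub>R v) /\<^sub>R \<bar>s\<bar>)) \<longlongrightarrow> 0) (at 0)" by (rule tendsto_norm_zero)
    moreover have "\<forall>\<^sub>F s in at 0. norm ((c s - c 0 - s *\<^sub>R v) /\<^sub>R \<bar>s\<bar>) = norm ((1 / s) *\<^sub>R (c s - x) - v)"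
    proof (rule eventually_at_topological[THEN iffD2], intro exI[of _ UNIV] conjI ballI impI)
      fix s :: real assume "s \<noteq> 0"
      then have "(1 / s) *\<^sub>R (c s - x) - v = (1 / s) *\<^sub>R (c s - c 0 - s *\<^sub>R v)"
        by (simp add: c(1) scaleR_diff_right)
      then show "norm ((c s - c 0 - s *\<^sub>R v) /\<^sub>R \<bar>s\<bar>) = norm ((1 / s) *\<^sub>R (c s - x) - v)"
        by (simp add: divide_inverse_commute abs_inverse)
    qed auto
    ultimately have "((\<lambda>s. norm ((1 / s) *\<^sub>R (c s - x) - v)) \<longlongrightarrow> 0) (at 0)"
      by (rule Lim_transform_eventually)
    then show ?thesis by (rule LIM_zero_cancel[OF tendsto_norm_zero_cancel])
  qed
  have no: False if w: "n \<bullet> (\<sigma> *\<^sub>R v) < 0" "\<sigma> = 1 \<or> \<sigma> = -1" for \<sigma>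
  proof -
    obtain s0 where s0: "s0 > 0" "x + s0 *\<^sub>R (\<sigma> *\<^sub>R v) \<in> interior W" using cone w(1) by blast
    obtain r where r: "r > 0"
      "\<And>s u. 0 < s \<Longrightarrow> s \<le> s0 \<Longrightarrow> norm (u - \<sigma> *\<^sub>R v) < r \<Longrightarrow> x + s *\<^sub>R u \<in> interior W"
      using convex_interior_cone[OF W s0(2,1)] by blast
    have "\<forall>\<^sub>F s in at 0. c s \<in> frontier \<Omega> \<and> dist ((1 / s) *\<^sub>R (c s - x)) v < r"
      using c(2) tendstoD[OF lim r(1)] by eventually_elim auto
    then obtain d where d: "d > 0" "\<And>s. s \<noteq> 0 \<Longrightarrow> \<bar>s\<bar> < d \<Longrightarrow>
       c s \<in> frontier \<Omega> \<and> dist ((1 / s) *\<^sub>R (c s - x)) v < r"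
      unfolding eventually_at by (auto simp: dist_norm)
    define t where "t = min s0 (d / 2)"
    have t: "t > 0" "t \<le> s0" "t < d" using s0 d by (auto simp: t_def)
    define s where "s = \<sigma> * t"
    have s: "s \<noteq> 0" "\<bar>s\<bar> < d" using t w(2) by (auto simp: s_def)
    have "x + t *\<^sub>R (\<sigma> *\<^sub>R ((1 / s) *\<^sub>R (c s - x))) \<in> interior W"
    proof (rule r(2)[OF t(1,2)])
      have "norm (\<sigma> *\<^sub>R ((1 / s) *\<^sub>R (c s - x)) - \<sigma> *\<^sub>R v) = \<bar>\<sigma>\<bar> * norm ((1 / s) *\<^sub>R (c s - x) - v)"
        by (metis norm_scaleR scaleR_diff_right)
      then show "norm (\<sigma> *\<^sub>R ((1 / s) *\<^sub>R (c s - x)) - \<sigma> *\<^sub>R v) < r"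
        using d(2)[OF s] w(2) by (auto simp: dist_norm)
    qed
    moreover have "x + t *\<^sub>R (\<sigma> *\<^sub>R ((1 / s) *\<^sub>R (c s - x))) = c s"
      using t w(2) by (auto simp: s_def)
    ultimately show False using d(2)[OF s] off by auto
  qed
  show "n \<bullet> v = 0" using no[of 1] no[of "-1"] by (cases "n \<bullet> v" "0::real" rule: linorder_cases) auto
qed

definition smooth_wall :: "'a::euclidean_space set \<Rightarrow> 'a set \<Rightarrow> bool" where
  "smooth_wall \<Omega> W \<longleftrightarrow> closed W \<and> convex W \<and> interior W \<noteq> {} \<and>
     (\<forall>q\<in>frontier W. smooth_hypersurface_near (frontier W) q) \<and> \<Omega> \<inter> W = {}"

section \<open>The momentum of a direction\<close>

definition momentum :: "('a::euclidean_space \<Rightarrow> real) \<Rightarrow> 'a \<Rightarrow> 'a \<Rightarrow> real" where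
  "momentum N v = frechet_derivative N (at v)"

text \<open>
  The right derivative is the velocity of the outgoing segment, also at a collision, where the
  trajectory is in general not differentiable.
\<close>

definition paired_momentum ::
  "('a::euclidean_space \<Rightarrow> real) \<Rightarrow> (real \<Rightarrow> 'a) \<Rightarrow> 'a \<Rightarrow> real \<Rightarrow> real" where
  "paired_momentum N \<gamma> p t = momentum N (vector_derivative \<gamma> (at_right t)) (\<gamma> t - p)"

context
  fixes N :: "'a::euclidean_space \<Rightarrow> real"
  assumes N: "minkowski_norm N"
begin

lemma minkowski_norm_scale: "t \<ge> 0 \<Longrightarrow> N (t *\<^sub>R x) = t * N x"
  and minkowski_norm_triangle: "N (x + y) \<le> N x + N y"
  using N unfolding minkowski_norm_def by auto

lemma minkowski_norm_zero: "N 0 = 0"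
  using minkowski_norm_scale[of 0 0] by simp

lemma has_derivative_momentum:
  assumes "v \<noteq> 0"
  shows "(N has_derivative momentum N v) (at v)"
proof -
  have "N differentiable (at v)"
    using N assms unfolding minkowski_norm_def C1_on_def differentiable_def by auto
  then show ?thesis unfolding momentum_def by (simp add: frechet_derivative_works)
qed

lemma linear_momentum: "v \<noteq> 0 \<Longrightarrow> linear (momentum N v)"
  using has_derivative_momentum has_derivative_linear by blast

text \<open>
  The differential of a positively homogeneous function is homogeneous of degree 0, so the
  momentum depends on the direction of a segment and not on its length.
\<close>

lemma has_derivative_momentum_scaled:
  assumes "v \<noteq> 0" "s > 0"
  shows "(N has_derivative momentum N v) (at (s *\<^sub>R v))"
proof -
  interpret linear "momentum N v" by (rule linear_momentum[OF assms(1)])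
  have "((\<lambda>x. (1 / s) *\<^sub>R x) has_derivative (\<lambda>x. (1 / s) *\<^sub>R x)) (at (s *\<^sub>R v))"
    by (auto intro!: derivative_eq_intros)
  moreover have "(N has_derivative momentum N v) (at ((1 / s) *\<^sub>R s *\<^sub>R v))"
    using has_derivative_momentum[OF assms(1)] assms(2) by simp
  ultimately have "((\<lambda>x. N ((1 / s) *\<^sub>R x)) has_derivative (\<lambda>x. momentum N v ((1 / s) *\<^sub>R x))) (at (s *\<^sub>R v))"
    using has_derivative_compose by blast
  then have "((\<lambda>x. s * N ((1 / s) *\<^sub>R x)) has_derivative (\<lambda>x. s * momentum N v ((1 / s) *\<^sub>R x))) (at (s *\<^sub>R v))"
    by (rule has_derivative_mult_right)
  moreover have "(\<lambda>x. s * N ((1 / s) *\<^sub>R x)) = N"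
    using assms(2) minkowski_norm_scale[of "1 / s"] by auto
  moreover have "(\<lambda>x. s * momentum N v ((1 / s) *\<^sub>R x)) = momentum N v"
    using assms(2) by (auto simp: scaleR)
  ultimately show ?thesis by simp
qed

lemma momentum_along:
  assumes "v \<noteq> 0"
  shows "((\<lambda>s. N (v + s *\<^sub>R w)) has_real_derivative momentum N v w) (at 0)"
proof -
  have "((\<lambda>s::real. v + s *\<^sub>R w) has_derivative (\<lambda>s. s *\<^sub>R w)) (at 0)"
    by (auto intro!: derivative_eq_intros)
  moreover have "(N has_derivative momentum N v) (at (v + 0 *\<^sub>R w))"
    using has_derivative_momentum[OF assms] by simp
  ultimately have "((\<lambda>s. N (v + s *\<^sub>R w)) has_derivative (\<lambda>s. momentum N v (s *\<^sub>R w))) (at 0)"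
    by (rule has_derivative_compose)
  moreover have "(\<lambda>s. momentum N v (s *\<^sub>R w)) = (*) (momentum N v w)"
    using linear_scale[OF linear_momentum[OF assms]] by auto
  ultimately show ?thesis by (simp add: has_field_derivative_def)
qed

text \<open>
  The triangle inequality bounds the difference quotients of \<open>N\<close> at \<open>v\<close> with positive step in the
  direction \<open>w\<close> by \<open>N w\<close>.
\<close>

lemma momentum_le:
  assumes "v \<noteq> 0"
  shows "momentum N v w \<le> N w"
proof -
  have "((\<lambda>s. (N (v + s *\<^sub>R w) - N v) / s) \<longlongrightarrow> momentum N v w) (at_right 0)"
    using momentum_along[OF assms, of w] unfolding DERIV_def by (auto intro: tendsto_mono[OF at_le])
  moreover have "\<forall>\<^sub>F s in at_right 0. (N (v + s *\<^sub>R w) - N v) / s \<le> N w"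
    unfolding eventually_at_right_field
  proof (intro exI[of _ 1] conjI allI impI)
    fix s :: real assume "s > 0" "s < 1"
    then show "(N (v + s *\<^sub>R w) - N v) / s \<le> N w"
      using minkowski_norm_triangle[of v "s *\<^sub>R w"] minkowski_norm_scale[of s w] 
      by (simp add: divide_le_eq mult.commute)
  qed simp
  ultimately show ?thesis by (rule tendsto_upperbound) simp
qed

text \<open>Euler's identity for the homogeneous function \<open>N\<close>.\<close>

lemma momentum_self:
  assumes "v \<noteq> 0"
  shows "momentum N v v = N v"
proof -
  have "((\<lambda>s. N (v + s *\<^sub>R (-v))) has_real_derivative momentum N v (-v)) (at 0)"
    by (rule momentum_along[OF assms])
  moreover have "((\<lambda>s. N (v + s *\<^sub>R (-v))) has_real_derivative - N v) (at 0)"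
  proof (rule DERIV_cong_ev[THEN iffD1])
    show "\<forall>\<^sub>F s in nhds 0. (1 - s) * N v = N (v + s *\<^sub>R (-v))"
      unfolding eventually_nhds_metric
    proof (intro exI[of _ 1] conjI allI impI)
      fix s :: real assume "dist s 0 < 1"
      then have "1 - s \<ge> 0" by (simp add: dist_norm)
      from minkowski_norm_scale[OF this, of v] show "(1 - s) * N v = N (v + s *\<^sub>R (-v))"
        by (simp add: scaleR_diff_left)
    qed simp
    show "((\<lambda>s. (1 - s) * N v) has_real_derivative - N v) (at 0)"
      by (auto intro!: derivative_eq_intros)
  qed auto
  ultimately have "momentum N v (-v) = - N v" by (rule DERIV_unique)
  then show ?thesis using linear_neg[OF linear_momentum[OF assms]] by simp
qed

text \<open>
  The functional \<open>\<xi>(v)\<close> is bounded by \<open>N\<close>. If it took the value 1 at two unit vectors it would be 1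
  on the segment between them, which would then lie in the unit sphere.
\<close>

lemma momentum_pairing_strict:
  assumes "N u = 1" "N v = 1" "momentum N v u = 1"
  shows "u = v"
proof (rule ccontr)
  assume "u \<noteq> v"
  have v0: "v \<noteq> 0" using assms(2) minkowski_norm_zero by auto
  have "closed_segment u v \<subseteq> {x. N x = 1}"
  proof
    fix x assume "x \<in> closed_segment u v"
    then obtain s where s: "0 \<le> s" "s \<le> 1" and x: "x = (1 - s) *\<^sub>R u + s *\<^sub>R v"
      by (auto simp: in_segment)
    have "N x \<le> 1" unfolding x
      using minkowski_norm_triangle[of "(1 - s) *\<^sub>R u" "s *\<^sub>R v"] s assms(1,2)
      by (simp add: minkowski_norm_scale)
    moreover have "momentum N v x = 1" unfolding x
      using linear_momentum[OF v0] assms momentum_self[OF v0]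
      by (simp add: linear_add linear_scale)
    ultimately show "x \<in> {x. N x = 1}" using momentum_le[OF v0, of x] by simp
  qed
  then show False using \<open>u \<noteq> v\<close> N unfolding minkowski_norm_def by blast
qed

section \<open>Collisions\<close>

lemma momentum_jump_of_critical_point:
  assumes v: "N v1 = 1" "N v2 = 1" and h: "h1 > 0" "h2 > 0"
    and crit: "critical_point_on (\<lambda>z. N (z - (x - h1 *\<^sub>R v1)) + N (x + h2 *\<^sub>R v2 - z)) M x"
    and w: "w \<in> tangent_vectors M x"
  shows "momentum N v2 w = momentum N v1 w"
proof -
  have v0: "v1 \<noteq> 0" "v2 \<noteq> 0" using v minkowski_norm_zero by auto
  have d1: "((\<lambda>z. N (z - (x - h1 *\<^sub>R v1))) has_derivative (\<lambda>z. momentum N v1 z)) (at x)"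
  proof (rule has_derivative_compose[of "\<lambda>z. z - (x - h1 *\<^sub>R v1)" "\<lambda>z. z"])
    show "((\<lambda>z. z - (x - h1 *\<^sub>R v1)) has_derivative (\<lambda>z. z)) (at x)"
      by (auto intro!: derivative_eq_intros)
    show "(N has_derivative momentum N v1) (at (x - (x - h1 *\<^sub>R v1)))"
      using has_derivative_momentum_scaled[OF v0(1) h(1)] by simp
  qed
  have d2: "((\<lambda>z. N (x + h2 *\<^sub>R v2 - z)) has_derivative (\<lambda>z. momentum N v2 (- z))) (at x)"
  proof (rule has_derivative_compose[of "\<lambda>z. x + h2 *\<^sub>R v2 - z" "\<lambda>z. - z"])
    show "((\<lambda>z. x + h2 *\<^sub>R v2 - z) has_derivative (\<lambda>z. - z)) (at x)"
      by (auto intro!: derivative_eq_intros)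
    show "(N has_derivative momentum N v2) (at (x + h2 *\<^sub>R v2 - x))"
      using has_derivative_momentum_scaled[OF v0(2) h(2)] by simp
  qed
  obtain f' where f': "((\<lambda>z. N (z - (x - h1 *\<^sub>R v1)) + N (x + h2 *\<^sub>R v2 - z)) has_derivative f') (at x)"
    "f' w = 0" using crit w unfolding critical_point_on_def by blast
  have "f' = (\<lambda>z. momentum N v1 z + momentum N v2 (- z))"
    using has_derivative_unique[OF f'(1) has_derivative_add[OF d1 d2]] .
  then show ?thesis using f'(2) linear_neg[OF linear_momentum[OF v0(2)]] by simp
qed

text \<open>
  The jump is \<open>c n\<close>. Evaluated at \<open>v2\<close> and at \<open>- v1\<close> it gives \<open>1 - \<xi>(v1) v2 \<ge> 0\<close> and
  \<open>1 - \<xi>(v2) v1 \<ge> 0\<close>, while \<open>n \<bullet> v2\<close> and \<open>n \<bullet> (- v1)\<close> are nonnegative, so \<open>c \<ge> 0\<close> unless both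
  velocities are tangent. Then both differences vanish, and strict convexity gives \<open>v1 = v2\<close>.
\<close>

lemma momentum_jump_nonneg:
  assumes v: "N v1 = 1" "N v2 = 1" and n: "n \<noteq> 0"
    and eq: "\<And>w. n \<bullet> w = 0 \<Longrightarrow> momentum N v2 w = momentum N v1 w"
    and sgn: "n \<bullet> v1 \<le> 0" "n \<bullet> v2 \<ge> 0" and z: "n \<bullet> z \<ge> 0"
  shows "momentum N v1 z \<le> momentum N v2 z"
proof -
  have v0: "v1 \<noteq> 0" "v2 \<noteq> 0" using v minkowski_norm_zero by auto
  have lin: "linear (\<lambda>w. momentum N v2 w - momentum N v1 w)"
    using linear_compose_sub[OF linear_momentum[OF v0(2)] linear_momentum[OF v0(1)]] .
  have "momentum N v2 w - momentum N v1 w = 0" if "n \<bullet> w = 0" for w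
    using eq[OF that] by simp
  from functional_vanishing_on_hyperplane[OF lin n this]
  obtain c where c: "\<And>w. momentum N v2 w - momentum N v1 w = c * (n \<bullet> w)" by blast
  have self: "momentum N v1 v1 = 1" "momentum N v2 v2 = 1"
    using momentum_self v0 v by auto
  have le: "momentum N v1 v2 \<le> 1" "momentum N v2 v1 \<le> 1"
    using momentum_le[OF v0(1), of v2] momentum_le[OF v0(2), of v1] v by auto
  have c1: "1 - momentum N v1 v2 = c * (n \<bullet> v2)" "1 - momentum N v2 v1 = c * (- (n \<bullet> v1))"
    using c[of v1] c[of v2] self by auto
  show ?thesis
  proof (cases "n \<bullet> v2 = 0 \<and> n \<bullet> v1 = 0")
    case True
    then have "v2 = v1" using momentum_pairing_strict[OF v(2,1)] c1 by simp
    then show ?thesis by simp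
  next
    case False
    have "c \<ge> 0"
    proof (rule ccontr)
      assume "\<not> ?thesis"
      then have "c * (n \<bullet> v2) \<le> 0" "c * (- (n \<bullet> v1)) \<le> 0" "c \<noteq> 0"
        using sgn by (auto simp: mult_le_0_iff zero_le_mult_iff)
      then have "c * (n \<bullet> v2) = 0" "c * (- (n \<bullet> v1)) = 0" using c1 le by linarith+
      then show False using False \<open>c \<noteq> 0\<close> by auto
    qed
    then have "c * (n \<bullet> z) \<ge> 0" using z by simp
    then show ?thesis using c[of z] by simp
  qed
qed

text \<open>
  Every direction pointing strictly into the tangent half-space of the wall enters its interior,
  which the closure of the table avoids. Hence \<open>- v1\<close> and \<open>v2\<close> point to the other side, while
  \<open>p \<in> W\<close> fixes the sign of \<open>n \<bullet> (x - p)\<close>.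
\<close>

lemma collision_momentum_jump:
  assumes wall: "smooth_wall \<Omega> W" and xW: "x \<in> W" and pW: "p \<in> W"
    and sm: "smooth_point \<Omega> x"
    and v: "N v1 = 1" "N v2 = 1" and h: "h > 0"
    and before: "\<And>s. 0 < s \<Longrightarrow> s \<le> h \<Longrightarrow> x - s *\<^sub>R v1 \<in> closure \<Omega>"
    and after: "\<And>s. 0 < s \<Longrightarrow> s \<le> h \<Longrightarrow> x + s *\<^sub>R v2 \<in> closure \<Omega>"
    and crit: "critical_point_on (\<lambda>z. N (z - (x - h *\<^sub>R v1)) + N (x + h *\<^sub>R v2 - z)) (frontier \<Omega>) x"
  shows "momentum N v1 (x - p) \<le> momentum N v2 (x - p)"
proof -
  have W: "closed W" "convex W" "interior W \<noteq> {}"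
    and smW: "\<And>q. q \<in> frontier W \<Longrightarrow> smooth_hypersurface_near (frontier W) q"
    and disj: "\<Omega> \<inter> W = {}" using wall by (auto simp: smooth_wall_def)
  have int: "interior W \<inter> closure \<Omega> = {}"
    using disj interior_subset[of W] by (subst open_Int_closure_eq_empty) auto
  have "x \<in> closure \<Omega>" using sm by (auto simp: smooth_point_def frontier_def)
  then have xf: "x \<in> frontier W" using int xW W(1) by (auto simp: frontier_def)
  obtain n where n: "n \<noteq> 0" and sup: "\<And>y. y \<in> W \<Longrightarrow> n \<bullet> (y - x) \<le> 0"
    and cone: "\<And>w. n \<bullet> w < 0 \<Longrightarrow> \<exists>s>0. x + s *\<^sub>R w \<in> interior W"
    using smooth_wall_tangent_halfspace[OF W xf smW[OF xf]] by blast
  have out: "n \<bullet> w \<ge> 0" if w: "\<And>s. 0 < s \<Longrightarrow> s \<le> h \<Longrightarrow> x + s *\<^sub>R w \<in> closure \<Omega>" for w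
  proof (rule ccontr)
    assume "\<not> ?thesis"
    then obtain s0 where s0: "s0 > 0" "x + s0 *\<^sub>R w \<in> interior W" using cone[of w] by auto
    then obtain r where r: "r > 0"
      "\<And>s u. 0 < s \<Longrightarrow> s \<le> s0 \<Longrightarrow> norm (u - w) < r \<Longrightarrow> x + s *\<^sub>R u \<in> interior W"
      using convex_interior_cone[OF W(2) xW s0(2,1)] by blast
    have "x + min s0 h *\<^sub>R w \<in> interior W" using r s0 h by auto
    moreover have "x + min s0 h *\<^sub>R w \<in> closure \<Omega>" using w s0 h by auto
    ultimately show False using int by blast
  qed
  have "n \<bullet> (- v1) \<ge> 0" using before by (intro out) simp
  then have in1: "n \<bullet> v1 \<le> 0" by simp
  have out2: "n \<bullet> v2 \<ge> 0" using after by (intro out) simp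
  have side: "n \<bullet> (x - p) \<ge> 0" using sup[OF pW] by (simp add: inner_diff_right)
  have eq: "momentum N v2 w = momentum N v1 w" if "n \<bullet> w = 0" for w
    using momentum_jump_of_critical_point[OF v h h crit, of w] that
      tangent_vectors_frontier_table[OF W(2) xW disj sm n cone] by blast
  show ?thesis by (rule momentum_jump_nonneg[OF v n eq in1 out2 side])
qed

section \<open>Growth of the momentum paired with the position\<close>

text \<open>
  Free motion and collisions become one case: near every interior time the trajectory is a pair
  of segments across which the pairing of momentum and position does not decrease.
\<close>

lemma trajectory_local_structure:
  assumes tr: "billiard_trajectory N \<Omega> I \<gamma>" and t: "t \<in> interior I"
    and walls: "\<And>x. x \<in> \<gamma> ` I \<Longrightarrow> x \<in> frontier \<Omega> \<Longrightarrow>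
       \<exists>W. smooth_wall \<Omega> W \<and> x \<in> W \<and> p \<in> W"
  shows "\<exists>h>0. \<exists>v1 v2. N v1 = 1 \<and> N v2 = 1 \<and>
     (\<forall>s\<in>{0..h}. \<gamma> (t - s) = \<gamma> t - s *\<^sub>R v1 \<and> \<gamma> (t + s) = \<gamma> t + s *\<^sub>R v2) \<and>
     momentum N v1 (\<gamma> t - p) \<le> momentum N v2 (\<gamma> t - p)"
proof -
  have clos: "\<gamma> ` I \<subseteq> closure \<Omega>" using tr unfolding billiard_trajectory_def by blast
  have "\<exists>d>0. {t - d<..<t + d} \<subseteq> I \<and>
        (\<forall>t1\<in>{t - d<..<t}. \<forall>t2\<in>{t<..<t + d}.
           unit_speed_segment N \<gamma> t1 t2 \<or>
           smooth_point \<Omega> (\<gamma> t) \<and>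
           unit_speed_segment N \<gamma> t1 t \<and> unit_speed_segment N \<gamma> t t2 \<and>
           critical_point_on (\<lambda>x. N (x - \<gamma> t1) + N (\<gamma> t2 - x)) (frontier \<Omega>) (\<gamma> t))"
    using tr t unfolding billiard_trajectory_def by (elim conjE) (erule (1) bspec)
  then obtain d where d: "d > 0" "{t - d<..<t + d} \<subseteq> I"
    and alt: "\<forall>t1\<in>{t - d<..<t}. \<forall>t2\<in>{t<..<t + d}.
           unit_speed_segment N \<gamma> t1 t2 \<or>
           smooth_point \<Omega> (\<gamma> t) \<and>
           unit_speed_segment N \<gamma> t1 t \<and> unit_speed_segment N \<gamma> t t2 \<and>
           critical_point_on (\<lambda>x. N (x - \<gamma> t1) + N (\<gamma> t2 - x)) (frontier \<Omega>) (\<gamma> t)"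
    by (elim exE conjE) (rule that)
  define h where "h = d / 2"
  have h: "h > 0" "h < d" using d by (auto simp: h_def)
  have tI: "t \<in> I" using t interior_subset by blast
  consider "unit_speed_segment N \<gamma> (t - h) (t + h)" |
    "smooth_point \<Omega> (\<gamma> t)" "unit_speed_segment N \<gamma> (t - h) t" "unit_speed_segment N \<gamma> t (t + h)"
    "critical_point_on (\<lambda>x. N (x - \<gamma> (t - h)) + N (\<gamma> (t + h) - x)) (frontier \<Omega>) (\<gamma> t)"
    using alt[THEN bspec, of "t - h", THEN bspec, of "t + h"] h by auto
  then show ?thesis
  proof cases
    case 1
    then obtain v where v: "N v = 1"
      "\<And>s. s \<in> {t - h..t + h} \<Longrightarrow> \<gamma> s = \<gamma> (t - h) + (s - (t - h)) *\<^sub>R v"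
      unfolding unit_speed_segment_def by blast
    have "\<gamma> (t - s) = \<gamma> t - s *\<^sub>R v \<and> \<gamma> (t + s) = \<gamma> t + s *\<^sub>R v" if "s \<in> {0..h}" for s
      using v(2)[of "t - s"] v(2)[of "t + s"] v(2)[of t] that h by (auto simp: algebra_simps)
    then show ?thesis using v(1) h(1) by blast
  next
    case 2
    obtain v1 where v1: "N v1 = 1"
      "\<And>s. s \<in> {t - h..t} \<Longrightarrow> \<gamma> s = \<gamma> (t - h) + (s - (t - h)) *\<^sub>R v1"
      using 2(2) unfolding unit_speed_segment_def by blast
    obtain v2 where v2: "N v2 = 1" "\<And>s. s \<in> {t..t + h} \<Longrightarrow> \<gamma> s = \<gamma> t + (s - t) *\<^sub>R v2"
      using 2(3) unfolding unit_speed_segment_def by blast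
    have b: "\<gamma> (t - s) = \<gamma> t - s *\<^sub>R v1" if "s \<in> {0..h}" for s
      using v1(2)[of "t - s"] v1(2)[of t] that h by (auto simp: algebra_simps)
    have a: "\<gamma> (t + s) = \<gamma> t + s *\<^sub>R v2" if "s \<in> {0..h}" for s
      using v2(2)[of "t + s"] that by auto
    have "\<gamma> t \<in> frontier \<Omega>" using 2(1) by (simp add: smooth_point_def)
    then obtain W where W: "smooth_wall \<Omega> W" "\<gamma> t \<in> W" "p \<in> W"
      using walls[of "\<gamma> t"] tI by blast
    have "momentum N v1 (\<gamma> t - p) \<le> momentum N v2 (\<gamma> t - p)"
    proof (rule collision_momentum_jump[OF W 2(1) v1(1) v2(1) h(1)])
      fix s assume s: "0 < s" "s \<le> h"
      then have "t - s \<in> I" "t + s \<in> I" using d(2) h by auto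
      then show "\<gamma> t - s *\<^sub>R v1 \<in> closure \<Omega>" "\<gamma> t + s *\<^sub>R v2 \<in> closure \<Omega>"
        using clos a[of s] b[of s] s by auto
    next
      show "critical_point_on (\<lambda>z. N (z - (\<gamma> t - h *\<^sub>R v1)) + N (\<gamma> t + h *\<^sub>R v2 - z)) (frontier \<Omega>) (\<gamma> t)"
        using 2(4) a[of h] b[of h] h by simp
    qed
    then show ?thesis using v1(1) v2(1) a b h(1) by blast
  qed
qed

lemma right_velocity_of_segment:
  fixes \<gamma> :: "real \<Rightarrow> 'a"
  assumes "h > 0" "\<And>s. s \<in> {0..h} \<Longrightarrow> \<gamma> (t + s) = \<gamma> t + s *\<^sub>R v"
  shows "vector_derivative \<gamma> (at_right t) = v"
proof (rule vector_derivative_within)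
  have "((\<lambda>s. \<gamma> t + (s - t) *\<^sub>R v) has_vector_derivative v) (at t within {t..})"
    by (auto intro!: derivative_eq_intros simp: has_vector_derivative_def)
  then have "(\<gamma> has_vector_derivative v) (at t within {t..})"
  proof (rule has_vector_derivative_transform_within)
    fix s assume "s \<in> {t..}" "dist s t < h"
    then show "\<gamma> t + (s - t) *\<^sub>R v = \<gamma> s" using assms(2)[of "s - t"] by (auto simp: dist_norm)
  qed (use assms in auto)
  then show "(\<gamma> has_vector_derivative v) (at_right t)" by (simp add: at_within_Ici_at_right)
qed simp

lemma paired_momentum_growth_local:
  assumes v: "N v1 = 1" "N v2 = 1" and h: "h > 0"
    and seg: "\<And>s. s \<in> {0..h} \<Longrightarrow> \<gamma> (t - s) = \<gamma> t - s *\<^sub>R v1"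
      "\<And>s. s \<in> {0..h} \<Longrightarrow> \<gamma> (t + s) = \<gamma> t + s *\<^sub>R v2"
    and jump: "momentum N v1 (\<gamma> t - p) \<le> momentum N v2 (\<gamma> t - p)"
    and ab: "a \<le> t" "t \<le> b" "b - a < h"
  shows "b - a \<le> paired_momentum N \<gamma> p b - paired_momentum N \<gamma> p a"
proof -
  have v0: "v1 \<noteq> 0" "v2 \<noteq> 0" using v minkowski_norm_zero by auto
  have lin: "momentum N v (x + s *\<^sub>R v) = momentum N v x + s" if "N v = 1" for v x s
  proof -
    have "v \<noteq> 0" using that minkowski_norm_zero by auto
    then show ?thesis
      using that linear_momentum[of v] momentum_self[of v] by (simp add: linear_add linear_scale)
  qed
  have after: "paired_momentum N \<gamma> p s = momentum N v2 (\<gamma> t - p) + (s - t)"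
    if s: "t \<le> s" "s < t + h" for s
  proof -
    have g: "\<gamma> s = \<gamma> t + (s - t) *\<^sub>R v2" using seg(2)[of "s - t"] s by auto
    have "vector_derivative \<gamma> (at_right s) = v2"
    proof (rule right_velocity_of_segment)
      fix u assume "u \<in> {0..t + h - s}"
      then show "\<gamma> (s + u) = \<gamma> s + u *\<^sub>R v2"
        using seg(2)[of "s + u - t"] s unfolding g by (auto simp: algebra_simps)
    qed (use s in auto)
    then show ?thesis
      unfolding paired_momentum_def g using lin[OF v(2), of "\<gamma> t - p" "s - t"]
      by (simp add: algebra_simps)
  qed
  have before: "paired_momentum N \<gamma> p s = momentum N v1 (\<gamma> t - p) + (s - t)"
    if s: "t - h < s" "s < t" for s
  proof -
    have g: "\<gamma> s = \<gamma> t + (s - t) *\<^sub>R v1" using seg(1)[of "t - s"] s by (auto simp: algebra_simps)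
    have "vector_derivative \<gamma> (at_right s) = v1"
    proof (rule right_velocity_of_segment)
      fix u assume "u \<in> {0..t - s}"
      then show "\<gamma> (s + u) = \<gamma> s + u *\<^sub>R v1"
        using seg(1)[of "t - (s + u)"] s unfolding g by (auto simp: algebra_simps)
    qed (use s in auto)
    then show ?thesis
      unfolding paired_momentum_def g using lin[OF v(1), of "\<gamma> t - p" "s - t"]
      by (simp add: algebra_simps)
  qed
  show ?thesis
    using after[of b] after[of a] before[of a] ab jump by (cases "a = t") auto
qed

text \<open>
  The local estimates hold at every time, so finitely many of them cover a compact interval and
  add up. Accumulation of collisions at an interior time is excluded by the notion of a trajectory.
\<close>

lemma paired_momentum_growth:
  assumes tr: "billiard_trajectory N \<Omega> I \<gamma>"
    and walls: "\<And>x. x \<in> \<gamma> ` I \<Longrightarrow> x \<in> frontier \<Omega> \<Longrightarrow>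
       \<exists>W. smooth_wall \<Omega> W \<and> x \<in> W \<and> p \<in> W"
    and ab: "a \<le> b" "{a..b} \<subseteq> interior I"
  shows "b - a \<le> paired_momentum N \<gamma> p b - paired_momentum N \<gamma> p a"
  using ab(1)
proof (induction rule: Bolzano)
  case (trans a b c)
  then show ?case by linarith
next
  case (local t)
  then have "t \<in> interior I" using ab(2) by auto
  from trajectory_local_structure[OF tr this walls]
  obtain h v1 v2 where "h > 0" "N v1 = 1" "N v2 = 1"
    "\<And>s. s \<in> {0..h} \<Longrightarrow> \<gamma> (t - s) = \<gamma> t - s *\<^sub>R v1"
    "\<And>s. s \<in> {0..h} \<Longrightarrow> \<gamma> (t + s) = \<gamma> t + s *\<^sub>R v2"
    "momentum N v1 (\<gamma> t - p) \<le> momentum N v2 (\<gamma> t - p)" by blast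
  then show ?case using paired_momentum_growth_local by blast
qed

lemma paired_momentum_bounds:
  assumes "billiard_trajectory N \<Omega> I \<gamma>" "t \<in> interior I"
    and "\<And>x. x \<in> \<gamma> ` I \<Longrightarrow> x \<in> frontier \<Omega> \<Longrightarrow>
       \<exists>W. smooth_wall \<Omega> W \<and> x \<in> W \<and> p \<in> W"
  shows "paired_momentum N \<gamma> p t \<le> N (\<gamma> t - p)" "- N (p - \<gamma> t) \<le> paired_momentum N \<gamma> p t"
proof -
  obtain h v1 v2 where h: "h > 0" "N v2 = 1" "\<And>s. s \<in> {0..h} \<Longrightarrow> \<gamma> (t + s) = \<gamma> t + s *\<^sub>R v2"
    using trajectory_local_structure[OF assms] by blast
  have v0: "v2 \<noteq> 0" using h minkowski_norm_zero by auto
  have e: "paired_momentum N \<gamma> p t = momentum N v2 (\<gamma> t - p)"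
    unfolding paired_momentum_def using right_velocity_of_segment[OF h(1,3)] by simp
  show "paired_momentum N \<gamma> p t \<le> N (\<gamma> t - p)" unfolding e by (rule momentum_le[OF v0])
  have "momentum N v2 (p - \<gamma> t) = - momentum N v2 (\<gamma> t - p)"
    using linear_neg[OF linear_momentum[OF v0], of "\<gamma> t - p"] by simp
  then show "- N (p - \<gamma> t) \<le> paired_momentum N \<gamma> p t"
    unfolding e using momentum_le[OF v0, of "p - \<gamma> t"] by simp
qed

end

lemma emeasure_interval_le:
  fixes I :: "real set"
  assumes I: "is_interval I" and e: "e \<ge> 0" and le: "\<And>a b. a \<le> b \<Longrightarrow> {a..b} \<subseteq> interior I \<Longrightarrow> b - a \<le> e"
  shows "emeasure lborel I \<le> ennreal e"
proof (cases "I = {}")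
  case False
  have diff: "b - a \<le> e" if ab: "a \<in> I" "b \<in> I" "a < b" for a b
  proof (rule field_le_epsilon)
    fix k :: real assume k: "k > 0"
    \<comment> \<open>The hypothesis only sees interior times, so \<open>a\<close> and \<open>b\<close> are approached from inside.\<close>
    define j where "j = min (k / 2) ((b - a) / 2)"
    have j: "j > 0" "2 * j \<le> k" "2 * j \<le> b - a" using k ab(3) by (auto simp: j_def min_def)
    have "{a<..<b} \<subseteq> I" using mem_is_interval_1_I[OF I ab(1,2)] by auto
    then have "{a<..<b} \<subseteq> interior I" by (simp add: interior_maximal)
    moreover have "{a + j..b - j} \<subseteq> {a<..<b}" using j by auto
    ultimately have "(b - j) - (a + j) \<le> e" using j by (intro le) auto
    then show "b - a \<le> e + k" using j by linarith
  qed
  obtain a0 where a0: "a0 \<in> I" using False by blast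
  have d: "b - a \<le> e" if "a \<in> I" "b \<in> I" for a b
    using diff[of a b] that e by (cases "a < b") auto
  have bd: "bdd_above I" "bdd_below I"
    using d[OF a0] d[OF _ a0] by (auto intro!: bdd_aboveI[of _ "a0 + e"] bdd_belowI[of _ "a0 - e"] simp: algebra_simps)
  have "Sup I \<le> a + e" if "a \<in> I" for a
    using False d[OF that] by (intro cSup_least) (auto simp: algebra_simps)
  then have "Sup I - e \<le> Inf I" using False by (intro cInf_greatest) (auto simp: algebra_simps)
  moreover have "Inf I \<le> Sup I" using a0 bd by (meson cInf_lower cSup_upper order_trans)
  moreover have "I \<subseteq> {Inf I..Sup I}" using bd by (auto intro: cInf_lower cSup_upper)
  ultimately show ?thesis
    using emeasure_mono[of I "{Inf I..Sup I}" lborel] by (simp add: ennreal_leI order_trans)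
qed simp

section \<open>Trajectories near a point are short\<close>

theorem theorem2:
  fixes N :: "'a::euclidean_space \<Rightarrow> real"
    and \<Omega> :: "'a set" and p :: 'a and \<epsilon> :: real
  assumes "minkowski_billiard N \<Omega>"
    and "semi_dispersing \<Omega>"
    and "p \<in> closure \<Omega>"
    and "\<epsilon> > 0"
  shows "\<exists>U. open U \<and> p \<in> U \<and>
           (\<forall>I \<gamma>. billiard_trajectory N \<Omega> I \<gamma> \<and> \<gamma> ` I \<subseteq> U \<longrightarrow>
                  emeasure lborel I \<le> ennreal \<epsilon>)"
proof -
  have N: "minkowski_norm N" and op: "open \<Omega>" using assms(1) by (auto simp: minkowski_billiard_def)
  obtain m :: nat and W where W: "\<And>i. i \<in> {1..m} \<Longrightarrow> closed (W i) \<and> convex (W i) \<and> interior (W i) \<noteq> {} \<and>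
           (\<forall>p\<in>frontier (W i). smooth_hypersurface_near (frontier (W i)) p)"
    and \<Omega>: "\<Omega> = UNIV - (\<Union>i\<in>{1..m}. W i)"
    using assms(2) unfolding semi_dispersing_def by blast
  \<comment> \<open>Removing the walls that miss \<open>p\<close> leaves an open set around \<open>p\<close>, as there are finitely many walls.\<close>
  define F where "F = (\<Union>i\<in>{i\<in>{1..m}. p \<notin> W i}. W i)"
  have F: "closed F" "p \<notin> F" unfolding F_def using W by (auto intro!: closed_UN)
  have contN: "continuous_on UNIV N" using N by (simp add: minkowski_norm_def)
  define U where "U = - F \<inter> ({x. N (x - p) < \<epsilon> / 2} \<inter> {x. N (p - x) < \<epsilon> / 2})"
  have "open U" unfolding U_def
    using F by (intro open_Int open_Compl open_Collect_less continuous_intros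
        continuous_on_compose2[OF contN]) auto
  moreover have "p \<in> U" using F assms(4) minkowski_norm_zero[OF N] by (simp add: U_def)
  moreover have "emeasure lborel I \<le> ennreal \<epsilon>"
    if tr: "billiard_trajectory N \<Omega> I \<gamma>" and sub: "\<gamma> ` I \<subseteq> U" for I \<gamma>
  proof (rule emeasure_interval_le[of _ \<epsilon>])
    show "\<epsilon> \<ge> 0" using assms(4) by simp
    show "is_interval I" using tr by (simp add: billiard_trajectory_def)
    have walls: "\<exists>W. smooth_wall \<Omega> W \<and> x \<in> W \<and> p \<in> W"
      if x: "x \<in> \<gamma> ` I" "x \<in> frontier \<Omega>" for x
    proof -
      have "x \<notin> \<Omega>" using x(2) op by (auto simp: frontier_def interior_open)
      then obtain i where i: "i \<in> {1..m}" "x \<in> W i" using \<Omega> by blast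
      have "x \<notin> F" using x(1) sub unfolding U_def by blast
      then have "p \<in> W i" using i unfolding F_def by blast
      moreover have "\<Omega> \<inter> W i = {}" using \<Omega> i(1) by blast
      then have "smooth_wall \<Omega> (W i)" using W[OF i(1)] unfolding smooth_wall_def by simp
      ultimately show ?thesis using i(2) by blast
    qed
    fix a b assume ab: "a \<le> b" "{a..b} \<subseteq> interior I"
    then have i: "a \<in> interior I" "b \<in> interior I" by auto
    then have "\<gamma> a \<in> U" "\<gamma> b \<in> U" using sub interior_subset by blast+
    then have "N (p - \<gamma> a) < \<epsilon> / 2" "N (\<gamma> b - p) < \<epsilon> / 2" by (auto simp: U_def)
    then show "b - a \<le> \<epsilon>"
      using paired_momentum_growth[OF N tr walls ab] paired_momentum_bounds(1)[OF N tr i(2) walls]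
        paired_momentum_bounds(2)[OF N tr i(1) walls] by linarith
  qed
  ultimately show ?thesis by blast
qed

end
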